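(* Let $\varphi:\mathbb{R}^2\to[0,\infty)$ be a stationary and ergodic random field, and consider Gilbert's disc model with geostatistical marking by $\varphi$, with occupied set $\mathcal{O}$. The following statements are equivalent: a) $\mathbf{P}_\lambda(0\in\mathcal{O})=1$ for some $\lambda>0$. b) $\mathbf{P}_\lambda(0\in\mathcal{O})=1$ for every $\lambda>0$. c) $\mathbf{P}_\lambda(\mathcal{O}=\mathbb{R}^2)=1$ for every $\lambda>0$.
   Context: Let $\eta$ be a homogeneous Poisson point process on $\mathbb{R}^2$ with intensity $\lambda$, identified with its support, with law $\mathbb{P}_\lambda$. Let $\varphi:\mathbb{R}^2\to[0,\infty)$ be a random field with law $\overline{\mathbb{P}}$, independent of $\eta$; $\mathbf{P}_\lambda=\mathbb{P}_\lambda\times\overline{\mathbb{P}}$. The field is taken to be jointly measurable in (randomness, position), and $\mathbf{P}_\lambda$ to be completed, so that all events considered are measurable. Stationary: finite-dimensional distributions are invariant under all translations. Ergodic: every event in the $\sigma$-algebra generated by the evaluation maps $\varphi\mapsto\varphi(x)$ that is invariant under all shifts $\varphi(\cdot)\mapsto\varphi(\cdot-x)$, $x\in\mathbb{R}^2$, has probability $0$ or $1$. The occupied set is $\mathcal{O}=\bigcup_{x\in\eta}B(x,\varphi(x))$, where $B(x,r)$ is the closed Euclidean disc of radius $r$ centred at $x$. *)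

theory Defs
  imports "HOL-Probability.Probability"
begin

section \<open>The Poisson point process\<close>

text \<open>A point configuration is identified with its support, a locally finite subset of the plane.
  The \<open>\<sigma>\<close>-algebra on configurations is the one generated by the counting maps
  \<open>\<eta> \<mapsto> card (\<eta> \<inter> B)\<close> for bounded Borel sets \<open>B\<close>.\<close>

definition config_space :: "(real^2) set set" where
  "config_space = {\<eta>. \<forall>B. bounded B \<longrightarrow> finite (\<eta> \<inter> B)}"

definition config_algebra :: "(real^2) set measure" where
  "config_algebra = sigma config_space
     {{\<eta> \<in> config_space. card (\<eta> \<inter> B) = k} | B k. B \<in> sets borel \<and> bounded B}"

text \<open>The one-dimensional distributions are written out, rather than taken from the library's
  Poisson distribution, because the latter is only specified for positive rates, whereas \<open>B\<close> may
  be a null set; with \<open>0 ^ 0 = 1\<close> the formula then says that \<open>B\<close> contains no points almost surely.\<close>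

definition poisson_law :: "real \<Rightarrow> (real^2) set measure \<Rightarrow> bool" where
  "poisson_law lam P \<longleftrightarrow>
     prob_space P \<and> space P = space config_algebra \<and> sets P = sets config_algebra \<and>
     (\<forall>B \<in> sets borel. bounded B \<longrightarrow> (\<forall>k.
        measure P {\<eta> \<in> space P. card (\<eta> \<inter> B) = k} =
          (lam * measure lborel B) ^ k / fact k * exp (- (lam * measure lborel B)))) \<and>
     (\<forall>(I :: nat set) B. finite I \<and> (\<forall>i\<in>I. B i \<in> sets borel \<and> bounded (B i)) \<and>
        disjoint_family_on B I \<longrightarrow>
        prob_space.indep_vars P (\<lambda>_. count_space UNIV) (\<lambda>i \<eta>. card (\<eta> \<inter> B i)) I)"

section \<open>Random fields\<close>

text \<open>A field is given as \<open>\<phi> \<omega> x\<close>, with randomness \<open>\<omega>\<close> in an arbitrary probability space \<open>M\<close>.\<close>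

definition random_field :: "'w measure \<Rightarrow> ('w \<Rightarrow> real^2 \<Rightarrow> real) \<Rightarrow> bool" where
  "random_field M \<phi> \<longleftrightarrow>
     prob_space M \<and> (\<forall>\<omega>\<in>space M. \<forall>x. 0 \<le> \<phi> \<omega> x) \<and>
     (\<lambda>(\<omega>, x). \<phi> \<omega> x) \<in> borel_measurable (M \<Otimes>\<^sub>M borel)"

definition stationary_field :: "'w measure \<Rightarrow> ('w \<Rightarrow> real^2 \<Rightarrow> real) \<Rightarrow> bool" where
  "stationary_field M \<phi> \<longleftrightarrow> (\<forall>I y. finite I \<longrightarrow>
     distr M (Pi\<^sub>M I (\<lambda>_. borel)) (\<lambda>\<omega>. \<lambda>x\<in>I. \<phi> \<omega> (x + y)) =
     distr M (Pi\<^sub>M I (\<lambda>_. borel)) (\<lambda>\<omega>. \<lambda>x\<in>I. \<phi> \<omega> x))"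

definition shift :: "real^2 \<Rightarrow> (real^2 \<Rightarrow> real) \<Rightarrow> real^2 \<Rightarrow> real" where
  "shift y f = (\<lambda>x. f (x - y))"

text \<open>Ergodicity concerns events in a space \<open>W\<close> of functions in which the field takes its values.
  \<open>W\<close> may be any translation-invariant set of functions \<open>\<real>\<^sup>2 \<rightarrow> [0,\<infinity>)\<close> containing all sample paths.
  It is kept as a parameter because the notion depends on it: on the set of all functions an event
  generated by evaluations depends on countably many coordinates only, so that the only
  shift-invariant ones are the empty set and the whole space, while a smaller path space can have
  more invariant events.\<close>

definition path_space :: "'w measure \<Rightarrow> ('w \<Rightarrow> real^2 \<Rightarrow> real) \<Rightarrow> (real^2 \<Rightarrow> real) set \<Rightarrow> bool" where
  "path_space M \<phi> W \<longleftrightarrow>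
     (\<forall>f\<in>W. \<forall>x. 0 \<le> f x) \<and> (\<forall>y. \<forall>f\<in>W. shift y f \<in> W) \<and> (\<forall>\<omega>\<in>space M. \<phi> \<omega> \<in> W)"

definition eval_algebra :: "(real^2 \<Rightarrow> real) set \<Rightarrow> (real^2 \<Rightarrow> real) measure" where
  "eval_algebra W = sigma W {{f \<in> W. f x \<in> B} | x B. B \<in> sets borel}"

definition ergodic_field :: "'w measure \<Rightarrow> ('w \<Rightarrow> real^2 \<Rightarrow> real) \<Rightarrow> (real^2 \<Rightarrow> real) set \<Rightarrow> bool" where
  "ergodic_field M \<phi> W \<longleftrightarrow> (\<forall>A \<in> sets (eval_algebra W).
     (\<forall>y. shift y ` A = A) \<longrightarrow> measure M {\<omega> \<in> space M. \<phi> \<omega> \<in> A} \<in> {0, 1})"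

section \<open>The disc model with geostatistical marking\<close>

definition occupied :: "(real^2) set \<Rightarrow> (real^2 \<Rightarrow> real) \<Rightarrow> (real^2) set" where
  "occupied \<eta> r = (\<Union>x\<in>\<eta>. cball x (r x))"

definition joint_law :: "(real^2) set measure \<Rightarrow> 'w measure \<Rightarrow> ((real^2) set \<times> 'w) measure" where
  "joint_law P M = completion (P \<Otimes>\<^sub>M M)"

text \<open>A set outside the completed \<open>\<sigma>\<close>-algebra gets probability 0, so \<open>joint_prob P M E = 1\<close> includes
  the measurability of \<open>E\<close>.\<close>

definition joint_prob :: "(real^2) set measure \<Rightarrow> 'w measure \<Rightarrow> ((real^2) set \<Rightarrow> 'w \<Rightarrow> bool) \<Rightarrow> real" where
  "joint_prob P M E =
     measure (joint_law P M) {z \<in> space (joint_law P M). E (fst z) (snd z)}"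

end

theory Submission
  imports Defs
begin

text \<open>Given the field, the origin is vacant with probability \<open>exp (- \<lambda> |D|)\<close>, where
  \<open>D = {x. |x| \<le> \<phi> x}\<close>, so it is almost surely covered iff \<open>|D| = \<infinity>\<close> almost surely, whatever
  \<open>\<lambda>\<close> is. To cover the whole plane it suffices that \<open>{x. |x| + k \<le> \<phi> x}\<close> has infinite area
  almost surely for every \<open>k\<close>, as some disc then contains the disc of radius \<open>k\<close> around the origin.

  The margin \<open>k\<close> is gained from stationarity. Call \<open>e\<close> with coordinates \<open>\<plusminus>1\<close> bad at \<open>q\<close> if for some
  \<open>n\<close> the set of \<open>x\<close> in \<open>q + {y. |y| \<le> e \<bullet> y + n}\<close> with \<open>|x - q| \<le> \<phi> x\<close> has infinite area. If
  \<open>|D| = \<infinity>\<close>, one of the four \<open>e\<close> is bad at the origin. Far out in the cone \<open>|x + r e| \<ge> |x| + r / 2\<close>,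
  so badness at \<open>- r e\<close> implies badness at the origin, with a margin \<open>r / 2\<close> to spare. Both
  events have the same probability and hence coincide up to a null set. That they have the same
  probability follows from the finite-dimensional distributions, which determine the moments of
  areas of bounded sets, and thus the Laplace transforms of all the areas.\<close>

section \<open>Void probabilities\<close>

text \<open>The function \<open>exp (- z)\<close> on the extended half-line, real-valued for use
  with \<open>measure\<close> and the Bochner integral. The value at \<open>\<top>\<close> is set by
  hand, since \<open>enn2real \<top>\<close> is 0 and would give 1 instead of 0.\<close>

definition exp_neg :: "ennreal \<Rightarrow> real" where
  "exp_neg z = (if z = \<top> then 0 else exp (- enn2real z))"

lemma exp_neg_eq_0_iff: "exp_neg z = 0 \<longleftrightarrow> z = \<top>"
  by (simp add: exp_neg_def)

lemma exp_neg_nonneg: "0 \<le> exp_neg z"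
  by (simp add: exp_neg_def)

lemma exp_neg_le_1: "exp_neg z \<le> 1"
  by (simp add: exp_neg_def)

lemma measurable_exp_neg [measurable]: "exp_neg \<in> borel_measurable borel"
  unfolding exp_neg_def [abs_def] by measurable

text \<open>The terms will be multiples of areas inside growing balls, hence finite. Only the limit
  can be infinite, and then the real exponents tend to minus infinity.\<close>

lemma exp_neg_tendsto:
  fixes X :: "nat \<Rightarrow> ennreal"
  assumes "X \<longlonglongrightarrow> L" and fin: "\<And>m. X m \<noteq> \<top>"
  shows "(\<lambda>m. exp_neg (X m)) \<longlonglongrightarrow> exp_neg L"
proof (cases "L = \<top>")
  case True
  have "(\<lambda>m. ennreal (enn2real (X m))) = X"
    using fin by (auto simp: fun_eq_iff ennreal_enn2real_if)
  then have "filterlim (\<lambda>m. enn2real (X m)) at_top sequentially"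
    using assms(1) True by (metis ennreal_tendsto_top_eq_at_top)
  then have "filterlim (\<lambda>m. - enn2real (X m)) at_bot sequentially"
    by (simp add: filterlim_uminus_at_top)
  then have "(\<lambda>m. exp (- enn2real (X m))) \<longlonglongrightarrow> 0"
    by (rule filterlim_compose[OF exp_at_bot])
  then show ?thesis using fin True by (simp add: exp_neg_def)
next
  case False
  then obtain l where l: "L = ennreal l" "l \<ge> 0" by (cases L) auto
  have "(\<lambda>m. enn2real (X m)) \<longlonglongrightarrow> l"
    using assms(1) l by (intro tendsto_enn2real) simp_all
  then have "(\<lambda>m. exp (- enn2real (X m))) \<longlonglongrightarrow> exp (- l)"
    by (intro tendsto_exp tendsto_minus)
  then show ?thesis using fin l by (simp add: exp_neg_def)
qed

section \<open>Exhaustion of a Borel set by balls\<close>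

lemma Int_ball_tendsto_emeasure:
  fixes D :: "'a::euclidean_space set"
  assumes "D \<in> sets borel"
  shows "(\<lambda>n. emeasure lborel (D \<inter> ball 0 (real n))) \<longlonglongrightarrow> emeasure lborel D"
proof -
  have "(\<lambda>n. emeasure lborel (D \<inter> ball 0 (real n)))
      \<longlonglongrightarrow> emeasure lborel (\<Union>n. D \<inter> ball 0 (real n))"
    using assms by (intro Lim_emeasure_incseq) (auto simp: incseq_def)
  moreover have "(\<Union>n. D \<inter> ball 0 (real n)) = D"
    using reals_Archimedean2 by auto
  ultimately show ?thesis by simp
qed

lemma emeasure_lborel_Int_ball_finite:
  fixes D :: "'a::euclidean_space set"
  assumes "D \<in> sets borel"
  shows "emeasure lborel (D \<inter> ball 0 r) < \<top>"
proof -
  have "emeasure lborel (D \<inter> ball 0 r) \<le> emeasure lborel (ball (0::'a) r)"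
    by (intro emeasure_mono) auto
  also have "\<dots> < \<top>"
    using emeasure_bounded_finite[of "ball (0::'a) r"] by (simp add: top.not_eq_extremum)
  finally show ?thesis .
qed

section \<open>Counting maps and void events\<close>

lemma finite_config_Int:
  assumes "\<eta> \<in> space config_algebra" "bounded B"
  shows "finite (\<eta> \<inter> B)"
  using assms unfolding config_algebra_def space_measure_of_conv config_space_def by blast

lemma measurable_count_config:
  assumes "B \<in> sets borel" "bounded B"
  shows "(\<lambda>\<eta>. card (\<eta> \<inter> B)) \<in> measurable config_algebra (count_space UNIV)"
proof -
  have sp: "space config_algebra = config_space"
    by (simp add: config_algebra_def space_measure_of_conv)
  have "(\<lambda>\<eta>. card (\<eta> \<inter> B)) -` {k} \<inter> space config_algebra \<in> sets config_algebra" for k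
  proof -
    have "(\<lambda>\<eta>. card (\<eta> \<inter> B)) -` {k} \<inter> config_space
        \<in> {{\<eta> \<in> config_space. card (\<eta> \<inter> B) = k} |B k. B \<in> sets borel \<and> bounded B}"
      using assms by (auto intro!: exI[of _ B] exI[of _ k])
    then show ?thesis
      unfolding sp by (auto simp: config_algebra_def sets_measure_of_conv intro!: sigma_sets.Basic)
  qed
  then show ?thesis
    by (subst measurable_count_space_eq_countable) auto
qed

text \<open>Since \<open>card\<close> is 0 on infinite sets too, a vanishing count means emptiness
  only on bounded pieces, where configurations are finite. Countably many balls exhaust the
  plane.\<close>

lemma config_void_eq:
  "{\<eta> \<in> space config_algebra. \<eta> \<inter> D = {}} =
    (\<Inter>n. {\<eta> \<in> space config_algebra. card (\<eta> \<inter> (D \<inter> ball 0 (real n))) = 0})"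
proof -
  have "\<eta> \<inter> D = {} \<longleftrightarrow> (\<forall>n. card (\<eta> \<inter> (D \<inter> ball 0 (real n))) = 0)"
    if "\<eta> \<in> space config_algebra" for \<eta>
  proof -
    have "finite (\<eta> \<inter> (D \<inter> ball 0 (real n)))" for n
      using that by (rule finite_config_Int) (auto intro: bounded_subset[OF bounded_ball])
    then have "(\<forall>n. card (\<eta> \<inter> (D \<inter> ball 0 (real n))) = 0) \<longleftrightarrow>
        (\<forall>n. \<eta> \<inter> (D \<inter> ball 0 (real n)) = {})"
      by simp
    also have "\<dots> \<longleftrightarrow> \<eta> \<inter> D = {}"
    proof -
      have "\<exists>n. x \<in> ball 0 (real n)" for x :: "real^2"
        using reals_Archimedean2 by auto
      then show ?thesis by blast
    qed
    finally show ?thesis ..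
  qed
  then show ?thesis by blast
qed

text \<open>The law fixes the counts of bounded sets only. The void events of the pieces of
  \<open>D\<close> in growing balls decrease to that of \<open>D\<close>, so continuity from above
  extends the formula to infinite area, where \<open>D\<close> is hit almost surely.\<close>

lemma poisson_void:
  assumes P: "poisson_law lam P" and lam: "lam > 0" and D: "D \<in> sets borel"
  shows "measure P {\<eta> \<in> space P. \<eta> \<inter> D = {}} = exp_neg (ennreal lam * emeasure lborel D)"
proof -
  interpret prob_space P using P by (simp add: poisson_law_def)
  have sP: "space P = space config_algebra" "sets P = sets config_algebra"
    using P by (auto simp: poisson_law_def)
  define A where "A n = {\<eta> \<in> space P. card (\<eta> \<inter> (D \<inter> ball 0 (real n))) = 0}" for n
  have fin: "finite (\<eta> \<inter> (D \<inter> ball 0 (real n)))" if "\<eta> \<in> space P" for \<eta> n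
    using that unfolding sP
    by (rule finite_config_Int) (auto intro: bounded_subset[OF bounded_ball])
  have bD: "D \<inter> ball 0 (real n) \<in> sets borel" "bounded (D \<inter> ball 0 (real n))" for n
    using D by (auto intro: bounded_subset[OF bounded_ball])
  have A_sets: "A n \<in> sets P" for n
  proof -
    have [measurable]: "(\<lambda>\<eta>. card (\<eta> \<inter> (D \<inter> ball 0 (real n)))) \<in> measurable P (count_space UNIV)"
      using measurable_count_config[OF bD] measurable_cong_sets[OF sP(2) refl] by blast
    show ?thesis unfolding A_def by measurable
  qed
  have "decseq A"
  proof (intro decseq_SucI subsetI)
    fix n \<eta> assume "\<eta> \<in> A (Suc n)"
    then have "\<eta> \<in> space P" "\<eta> \<inter> (D \<inter> ball 0 (real (Suc n))) = {}"
      using fin[of \<eta> "Suc n"] by (auto simp: A_def)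
    moreover from this have "\<eta> \<inter> (D \<inter> ball 0 (real n)) = {}" by force
    ultimately show "\<eta> \<in> A n" by (simp add: A_def)
  qed
  then have "(\<lambda>n. measure P (A n)) \<longlonglongrightarrow> measure P (\<Inter>n. A n)"
    using A_sets by (intro finite_Lim_measure_decseq) auto
  moreover have "(\<Inter>n. A n) = {\<eta> \<in> space P. \<eta> \<inter> D = {}}"
    unfolding A_def sP(1) using config_void_eq[of D] by simp
  moreover have "measure P (A n) = exp_neg (ennreal lam * emeasure lborel (D \<inter> ball 0 (real n)))" for n
  proof -
    \<comment> \<open>The Poisson formula at \<open>k = 0\<close>, where the power and the factorial
      are both 1.\<close>
    have "measure P (A n) = exp (- (lam * measure lborel (D \<inter> ball 0 (real n))))"
      unfolding A_def using P bD[of n] by (auto simp: poisson_law_def)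
    moreover have "ennreal lam * emeasure lborel (D \<inter> ball 0 (real n)) =
        ennreal (lam * measure lborel (D \<inter> ball 0 (real n)))"
      using emeasure_lborel_Int_ball_finite[OF D, of "real n"] lam
      by (simp add: emeasure_eq_ennreal_measure ennreal_mult)
    ultimately show ?thesis using lam by (simp add: exp_neg_def)
  qed
  ultimately have "(\<lambda>n. exp_neg (ennreal lam * emeasure lborel (D \<inter> ball 0 (real n))))
      \<longlonglongrightarrow> measure P {\<eta> \<in> space P. \<eta> \<inter> D = {}}"
    by simp
  moreover have "(\<lambda>n. exp_neg (ennreal lam * emeasure lborel (D \<inter> ball 0 (real n))))
      \<longlonglongrightarrow> exp_neg (ennreal lam * emeasure lborel D)"
    using emeasure_lborel_Int_ball_finite[OF D, THEN less_imp_neq]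
    by (intro exp_neg_tendsto ennreal_tendsto_cmult Int_ball_tendsto_emeasure D)
      (simp_all add: ennreal_mult_eq_top_iff)
  ultimately show ?thesis by (rule LIMSEQ_unique)
qed

section \<open>The random set hit by the Poisson process\<close>

text \<open>Dynkin argument in \<open>S\<close>: on a rectangle the count is a counting map of the
  configuration times an indicator of the randomness. The ball keeps the counts finite, so that the
  count of a complement is a difference.\<close>

lemma measurable_count_section:
  assumes P: "space P = space config_algebra" "sets P = sets config_algebra"
    and S: "S \<in> sets (M \<Otimes>\<^sub>M borel)"
  shows "(\<lambda>z. emeasure (count_space UNIV) {x \<in> fst z \<inter> ball 0 r. (snd z, x) \<in> S})
    \<in> borel_measurable (P \<Otimes>\<^sub>M M)"
proof -
  let ?N = "\<lambda>S z. emeasure (count_space UNIV) {x \<in> fst z \<inter> ball 0 r. (snd z, x) \<in> S}"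
  have fin: "finite (fst z \<inter> ball 0 r \<inter> B)" if "z \<in> space (P \<Otimes>\<^sub>M M)" for z B
  proof -
    have "finite (fst z \<inter> ball 0 r)"
      using that P by (intro finite_config_Int) (auto simp: space_pair_measure)
    then show ?thesis by blast
  qed
  have S': "S \<in> sigma_sets (space M \<times> UNIV) {a \<times> b |a b. a \<in> sets M \<and> b \<in> sets borel}"
    using S by (simp add: sets_pair_measure)
  have basic: "?N (a \<times> b) \<in> borel_measurable (P \<Otimes>\<^sub>M M)" if [measurable]: "a \<in> sets M" and "b \<in> sets borel" for a b
  proof -
    have [measurable]: "(\<lambda>\<eta>. card (\<eta> \<inter> (ball 0 r \<inter> b))) \<in> measurable P (count_space UNIV)"
      using measurable_count_config[of "ball 0 r \<inter> b"] that measurable_cong_sets[OF P(2) refl]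
      by (auto intro: bounded_subset[OF bounded_ball])
    have "?N (a \<times> b) z = of_nat (card (fst z \<inter> (ball 0 r \<inter> b))) * indicator a (snd z)"
      if "z \<in> space (P \<Otimes>\<^sub>M M)" for z
    proof -
      have "{x \<in> fst z \<inter> ball 0 r. (snd z, x) \<in> a \<times> b} =
          (if snd z \<in> a then fst z \<inter> ball 0 r \<inter> b else {})" by auto
      then show ?thesis using fin[OF that, of b] by (simp add: Int_assoc)
    qed
    moreover have "(\<lambda>z. of_nat (card (fst z \<inter> (ball 0 r \<inter> b))) * indicator a (snd z) :: ennreal)
        \<in> borel_measurable (P \<Otimes>\<^sub>M M)"
      by measurable
    ultimately show ?thesis by (subst measurable_cong)
  qed
  show ?thesis
  proof (rule sigma_sets_induct_disjoint[OF Int_stable_pair_measure_generator _ S'])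
    show "{a \<times> b |a b. a \<in> sets M \<and> b \<in> sets borel} \<subseteq> Pow (space M \<times> UNIV)"
      using sets.sets_into_space by fastforce
    show "?N A \<in> borel_measurable (P \<Otimes>\<^sub>M M)"
      if "A \<in> {a \<times> b |a b. a \<in> sets M \<and> b \<in> sets borel}" for A
      using that basic by auto
    show "?N {} \<in> borel_measurable (P \<Otimes>\<^sub>M M)" by simp
  next
    fix A assume [measurable]: "?N A \<in> borel_measurable (P \<Otimes>\<^sub>M M)"
    have [measurable]: "?N (space M \<times> UNIV) \<in> borel_measurable (P \<Otimes>\<^sub>M M)"
      by (rule basic) auto
    have "?N (space M \<times> UNIV - A) z = ?N (space M \<times> UNIV) z - ?N A z"
      if z: "z \<in> space (P \<Otimes>\<^sub>M M)" for z
    proof -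
      have "{x \<in> fst z \<inter> ball 0 r. (snd z, x) \<in> space M \<times> UNIV - A} =
        {x \<in> fst z \<inter> ball 0 r. (snd z, x) \<in> space M \<times> UNIV} - {x \<in> fst z \<inter> ball 0 r. (snd z, x) \<in> A}"
        by auto
      moreover have "finite {x \<in> fst z \<inter> ball 0 r. (snd z, x) \<in> A}"
        using fin[OF z, of UNIV] by (auto intro: rev_finite_subset)
      moreover have "{x \<in> fst z \<inter> ball 0 r. (snd z, x) \<in> A} \<subseteq>
          {x \<in> fst z \<inter> ball 0 r. (snd z, x) \<in> space M \<times> UNIV}"
        using z by (auto simp: space_pair_measure)
      ultimately show ?thesis
        by (simp only:) (intro emeasure_Diff; simp)
    qed
    moreover have "(\<lambda>z. ?N (space M \<times> UNIV) z - ?N A z) \<in> borel_measurable (P \<Otimes>\<^sub>M M)"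
      by measurable
    ultimately show "?N (space M \<times> UNIV - A) \<in> borel_measurable (P \<Otimes>\<^sub>M M)"
      by (subst measurable_cong)
  next
    fix A :: "nat \<Rightarrow> _" assume "disjoint_family A"
      and [measurable]: "\<And>i. ?N (A i) \<in> borel_measurable (P \<Otimes>\<^sub>M M)"
    have "?N (\<Union>(range A)) z = (\<Sum>i. ?N (A i) z)" for z
    proof -
      have "{x \<in> fst z \<inter> ball 0 r. (snd z, x) \<in> \<Union>(range A)} =
        (\<Union>i. {x \<in> fst z \<inter> ball 0 r. (snd z, x) \<in> A i})" by auto
      moreover have "disjoint_family (\<lambda>i. {x \<in> fst z \<inter> ball 0 r. (snd z, x) \<in> A i})"
        using \<open>disjoint_family A\<close> by (auto simp: disjoint_family_on_def)
      ultimately show ?thesis by (simp add: suminf_emeasure)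
    qed
    then have "?N (\<Union>(range A)) = (\<lambda>z. \<Sum>i. ?N (A i) z)" by (rule ext)
    moreover have "(\<lambda>z. \<Sum>i. ?N (A i) z) \<in> borel_measurable (P \<Otimes>\<^sub>M M)" by measurable
    ultimately show "?N (\<Union>(range A)) \<in> borel_measurable (P \<Otimes>\<^sub>M M)" by (simp only:)
  qed
qed

text \<open>The quantifier runs over the points of a random set, so measurability is drawn from the
  counts: a hit is a nonzero count in one of countably many balls.\<close>

lemma sets_hit:
  assumes P: "space P = space config_algebra" "sets P = sets config_algebra"
    and S: "S \<in> sets (M \<Otimes>\<^sub>M borel)"
  shows "{z \<in> space (P \<Otimes>\<^sub>M M). \<exists>x\<in>fst z. (snd z, x) \<in> S} \<in> sets (P \<Otimes>\<^sub>M M)"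
proof -
  let ?N = "\<lambda>n z. emeasure (count_space UNIV) {x \<in> fst z \<inter> ball 0 (real n). (snd z, x) \<in> S}"
  have [measurable]: "?N n \<in> borel_measurable (P \<Otimes>\<^sub>M M)" for n
    using assms by (rule measurable_count_section)
  have "{z \<in> space (P \<Otimes>\<^sub>M M). \<exists>x\<in>fst z. (snd z, x) \<in> S} =
      (\<Union>n. {z \<in> space (P \<Otimes>\<^sub>M M). ?N n z \<noteq> 0})"
  proof -
    have ball: "\<exists>n. x \<in> ball 0 (real n)" for x :: "real^2"
      using reals_Archimedean2 by auto
    have "(\<exists>x\<in>\<eta>. (\<omega>, x) \<in> S) \<longleftrightarrow> (\<exists>n. {x \<in> \<eta> \<inter> ball 0 (real n). (\<omega>, x) \<in> S} \<noteq> {})"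
      for \<eta> \<omega>
    proof -
      have "{x \<in> \<eta> \<inter> ball 0 (real n). (\<omega>, x) \<in> S} \<noteq> {}"
        if "x \<in> ball 0 (real n)" "x \<in> \<eta>" "(\<omega>, x) \<in> S" for x n
        using that by blast
      with ball show ?thesis by blast
    qed
    moreover have "?N n z \<noteq> 0 \<longleftrightarrow> {x \<in> fst z \<inter> ball 0 (real n). (snd z, x) \<in> S} \<noteq> {}" for n z
      by (simp only: emeasure_count_space_eq_0 subset_UNIV simp_thms)
    ultimately show ?thesis by (simp only: set_eq_iff[of "Collect _"] mem_Collect_eq UN_iff) simp
  qed
  also have "\<dots> \<in> sets (P \<Otimes>\<^sub>M M)" by measurable
  finally show ?thesis .
qed

text \<open>The probability of a miss is the mean of \<open>exp_neg\<close> of \<open>lam\<close>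
  times the random area. It vanishes iff the integrand does almost surely, that is, iff the area is
  infinite. The positive factor \<open>lam\<close> does not affect this, whence the passage from one
  intensity to all.\<close>

lemma AE_hit_iff:
  assumes P: "poisson_law lam P" and lam: "lam > 0" and M: "prob_space M"
    and S: "S \<in> sets (M \<Otimes>\<^sub>M borel)"
  shows "(AE z in P \<Otimes>\<^sub>M M. \<exists>x\<in>fst z. (snd z, x) \<in> S) \<longleftrightarrow>
    (AE \<omega> in M. emeasure lborel {x. (\<omega>, x) \<in> S} = \<top>)"
proof -
  interpret Q: prob_space P using P by (simp add: poisson_law_def)
  interpret M: prob_space M by fact
  interpret pair_prob_space P M ..
  have sP: "space P = space config_algebra" "sets P = sets config_algebra"
    using P by (auto simp: poisson_law_def)
  let ?C = "{z \<in> space (P \<Otimes>\<^sub>M M). \<not> (\<exists>x\<in>fst z. (snd z, x) \<in> S)}"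
  note [measurable] = sets_hit[OF sP S]
  have C: "?C \<in> sets (P \<Otimes>\<^sub>M M)" by measurable
  have Sx: "{x. (\<omega>, x) \<in> S} \<in> sets borel" if "\<omega> \<in> space M" for \<omega>
  proof -
    have "{x. (\<omega>, x) \<in> S} = Pair \<omega> -` S" by auto
    then show ?thesis using sets_Pair1[OF S] by simp
  qed
  \<comment> \<open>The field is frozen and the configuration integrated out first, so that each
    section of the missed event is a void event.\<close>
  have "emeasure (P \<Otimes>\<^sub>M M) ?C = (\<integral>\<^sup>+\<omega>. emeasure P ((\<lambda>\<eta>. (\<eta>, \<omega>)) -` ?C) \<partial>M)"
    using C by (rule emeasure_pair_measure_alt2)
  also have "\<dots> = (\<integral>\<^sup>+\<omega>. ennreal (exp_neg (ennreal lam * emeasure lborel {x. (\<omega>, x) \<in> S})) \<partial>M)"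
  proof (rule nn_integral_cong)
    fix \<omega> assume w: "\<omega> \<in> space M"
    have "(\<lambda>\<eta>. (\<eta>, \<omega>)) -` ?C = {\<eta> \<in> space P. \<eta> \<inter> {x. (\<omega>, x) \<in> S} = {}}"
      using w by (auto simp: space_pair_measure)
    then show "emeasure P ((\<lambda>\<eta>. (\<eta>, \<omega>)) -` ?C) =
        ennreal (exp_neg (ennreal lam * emeasure lborel {x. (\<omega>, x) \<in> S}))"
      using poisson_void[OF P lam Sx[OF w]] by (simp add: Q.emeasure_eq_measure)
  qed
  finally have em: "emeasure (P \<Otimes>\<^sub>M M) ?C =
    (\<integral>\<^sup>+\<omega>. ennreal (exp_neg (ennreal lam * emeasure lborel {x. (\<omega>, x) \<in> S})) \<partial>M)" .
  have [measurable]: "(\<lambda>\<omega>. emeasure lborel {x. (\<omega>, x) \<in> S}) \<in> borel_measurable M"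
  proof -
    have "S \<in> sets (M \<Otimes>\<^sub>M lborel)" using S by (simp cong: sets_pair_measure_cong)
    from lborel.measurable_emeasure_Pair[OF this] show ?thesis by (simp add: vimage_def)
  qed
  have "(AE z in P \<Otimes>\<^sub>M M. \<exists>x\<in>fst z. (snd z, x) \<in> S) \<longleftrightarrow> emeasure (P \<Otimes>\<^sub>M M) ?C = 0"
    using C by (rule AE_iff_measurable) simp
  also have "\<dots> \<longleftrightarrow> (AE \<omega> in M. ennreal (exp_neg (ennreal lam * emeasure lborel {x. (\<omega>, x) \<in> S})) = 0)"
    unfolding em by (rule nn_integral_0_iff_AE) simp
  also have "\<dots> \<longleftrightarrow> (AE \<omega> in M. emeasure lborel {x. (\<omega>, x) \<in> S} = \<top>)"
    using lam by (intro AE_cong)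
      (simp add: ennreal_eq_zero_iff[OF exp_neg_nonneg] exp_neg_eq_0_iff ennreal_mult_eq_top_iff)
  finally show ?thesis .
qed

lemma joint_prob_eq_1_iff_AE:
  assumes "prob_space P" "prob_space M"
  shows "joint_prob P M E = 1 \<longleftrightarrow> (AE z in completion (P \<Otimes>\<^sub>M M). E (fst z) (snd z))"
proof -
  interpret Q: prob_space P by fact
  interpret M: prob_space M by fact
  interpret pair_prob_space P M ..
  let ?J = "completion (P \<Otimes>\<^sub>M M)"
  interpret J: prob_space ?J by (rule prob_space_completion)
  let ?A = "{z \<in> space ?J. E (fst z) (snd z)}"
  have jp: "joint_prob P M E = measure ?J ?A"
    by (simp add: joint_prob_def joint_law_def)
  show ?thesis
  proof
    assume "joint_prob P M E = 1"
    then have 1: "measure ?J ?A = 1" by (simp only: jp)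
    then have "?A \<in> sets ?J"
      using measure_notin_sets by fastforce
    from J.prob_eq_1[OF this] 1 show "AE z in ?J. E (fst z) (snd z)" by auto
  next
    assume AE: "AE z in ?J. E (fst z) (snd z)"
    then obtain N where N: "{z \<in> space ?J. \<not> E (fst z) (snd z)} \<subseteq> N" "N \<in> null_sets ?J"
      by (auto elim!: AE_E simp: null_sets_def)
    then have "{z \<in> space ?J. \<not> E (fst z) (snd z)} \<in> sets ?J"
      by (rule completion.complete)
    from sets.compl_sets[OF this] have "?A \<in> sets ?J"
      by (rule back_subst[of "\<lambda>A. A \<in> sets ?J"]) auto
    moreover have "AE z in ?J. z \<in> ?A"
      using AE AE_space[of ?J] by eventually_elim simp
    ultimately show "joint_prob P M E = 1"
      unfolding jp by (simp only: J.prob_eq_1)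
  qed
qed

lemma joint_prob_hit_eq_1_iff:
  assumes P: "poisson_law lam P" and lam: "lam > 0" and M: "prob_space M"
    and S: "S \<in> sets (M \<Otimes>\<^sub>M borel)"
  shows "joint_prob P M (\<lambda>\<eta> \<omega>. \<exists>x\<in>\<eta>. (\<omega>, x) \<in> S) = 1 \<longleftrightarrow>
    (AE \<omega> in M. emeasure lborel {x. (\<omega>, x) \<in> S} = \<top>)"
proof -
  have pP: "prob_space P" and sP: "space P = space config_algebra" "sets P = sets config_algebra"
    using P by (auto simp: poisson_law_def)
  note [measurable] = sets_hit[OF sP S]
  have "(AE z in completion (P \<Otimes>\<^sub>M M). \<exists>x\<in>fst z. (snd z, x) \<in> S) \<longleftrightarrow>
      (AE z in P \<Otimes>\<^sub>M M. \<exists>x\<in>fst z. (snd z, x) \<in> S)"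
    by (rule AE_completion_iff)
  then show ?thesis
    unfolding joint_prob_eq_1_iff_AE[OF pP M] AE_hit_iff[OF assms] .
qed

section \<open>Laplace transforms of random areas\<close>

text \<open>The exponential series may be integrated term by term, its partial sums being dominated
  by \<open>exp c\<close>; so the expectation is a limit of combinations of moments.\<close>

lemma expectation_exp_eq_if_moments_eq:
  fixes U V :: "'a \<Rightarrow> real"
  assumes "prob_space M"
    and [measurable]: "U \<in> borel_measurable M" "V \<in> borel_measurable M"
    and U: "\<And>x. \<bar>U x\<bar> \<le> c" and V: "\<And>x. \<bar>V x\<bar> \<le> c"
    and eq: "\<And>k. (\<integral>x. U x ^ k \<partial>M) = (\<integral>x. V x ^ k \<partial>M)"
  shows "(\<integral>x. exp (U x) \<partial>M) = (\<integral>x. exp (V x) \<partial>M)"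
proof -
  interpret prob_space M by fact
  have int: "integrable M (\<lambda>x. W x ^ k)"
    if [measurable]: "W \<in> borel_measurable M" and W: "\<And>x. \<bar>W x\<bar> \<le> c" for W :: "'a \<Rightarrow> real" and k
    using W by (intro integrable_const_bound[where B = "c ^ k"] AE_I2) (auto simp: power_abs intro!: power_mono)
  have lim: "(\<lambda>n. \<Sum>k<n. (\<integral>x. W x ^ k \<partial>M) / fact k) \<longlonglongrightarrow> (\<integral>x. exp (W x) \<partial>M)"
    if [measurable]: "W \<in> borel_measurable M" and W: "\<And>x. \<bar>W x\<bar> \<le> c" for W :: "'a \<Rightarrow> real"
  proof -
    have sums: "(\<lambda>k. z ^ k / fact k) sums exp z" for z :: real
      using exp_converges[of z] by (simp add: divide_inverse mult.commute)
    have "(\<lambda>n. \<integral>x. (\<Sum>k<n. W x ^ k / fact k) \<partial>M) \<longlonglongrightarrow> (\<integral>x. exp (W x) \<partial>M)"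
    proof (rule integral_dominated_convergence[where w = "\<lambda>_. exp c"])
      show "AE x in M. (\<lambda>n. \<Sum>k<n. W x ^ k / fact k) \<longlonglongrightarrow> exp (W x)"
        using sums unfolding sums_def by simp
      show "AE x in M. norm (\<Sum>k<n. W x ^ k / fact k) \<le> exp c" for n
      proof (rule AE_I2)
        fix x
        have c: "c \<ge> 0" using W[of x] by linarith
        have "norm (\<Sum>k<n. W x ^ k / fact k) \<le> (\<Sum>k<n. c ^ k / fact k)"
          using W by (intro sum_norm_le) (auto simp: power_abs intro!: divide_right_mono power_mono)
        also have "\<dots> \<le> exp c"
          using sum_le_suminf[OF sums_summable[OF sums], of "{..<n}" c] sums_unique[OF sums, of c] c
          by simp
        finally show "norm (\<Sum>k<n. W x ^ k / fact k) \<le> exp c" .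
      qed
    qed measurable
    moreover have "(\<integral>x. (\<Sum>k<n. W x ^ k / fact k) \<partial>M) = (\<Sum>k<n. (\<integral>x. W x ^ k \<partial>M) / fact k)" for n
      using int[OF that] by (subst Bochner_Integration.integral_sum) auto
    ultimately show ?thesis by simp
  qed
  show ?thesis
    using lim[of U] lim[of V] U V eq by (auto intro: LIMSEQ_unique)
qed

section \<open>Areas determined by a stationary field\<close>

lemma measurable_random_field_shift:
  assumes "random_field M \<phi>" and [measurable]: "g \<in> measurable N M" "h \<in> borel_measurable N"
  shows "(\<lambda>z. \<phi> (g z) (h z)) \<in> borel_measurable N"
proof -
  have "(\<lambda>(\<omega>, x). \<phi> \<omega> x) \<in> borel_measurable (M \<Otimes>\<^sub>M borel)"
    using assms(1) by (simp add: random_field_def)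
  from measurable_compose[OF _ this, of "\<lambda>z. (g z, h z)" N] show ?thesis by simp
qed

text \<open>The area of a region described relative to an observer at \<open>q\<close>:
  \<open>S\<close> constrains the relative position together with the field value there. As
  \<open>q\<close> enters through the field only, stationarity can remove it.\<close>

definition field_area :: "('w \<Rightarrow> real^2 \<Rightarrow> real) \<Rightarrow> ((real^2) \<times> real) set \<Rightarrow> real^2 \<Rightarrow> 'w \<Rightarrow> ennreal" where
  "field_area \<phi> S q \<omega> = emeasure lborel {y. (y, \<phi> \<omega> (y + q)) \<in> S}"

context
  fixes M :: "'w measure" and \<phi>
  assumes field: "random_field M \<phi>" and stat: "stationary_field M \<phi>"
begin

interpretation prob_space M using field by (simp add: random_field_def)

text \<open>Only the values at the points of \<open>I\<close> matter, and their joint law is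
  invariant. \<open>S\<close> may link each value to its position because \<open>I\<close> is
  fixed.\<close>

lemma stationary_finite_eq:
  assumes I: "finite I" and [measurable]: "S \<in> sets (borel \<Otimes>\<^sub>M borel)"
  shows "emeasure M {\<omega> \<in> space M. \<forall>y\<in>I. (y, \<phi> \<omega> (y + q)) \<in> S} =
    emeasure M {\<omega> \<in> space M. \<forall>y\<in>I. (y, \<phi> \<omega> y) \<in> S}"
proof -
  have *: "emeasure M {\<omega> \<in> space M. \<forall>y\<in>I. (y, \<phi> \<omega> (y + q)) \<in> S} =
      emeasure (distr M (Pi\<^sub>M I (\<lambda>_. borel)) (\<lambda>\<omega>. \<lambda>x\<in>I. \<phi> \<omega> (x + q)))
        {g \<in> space (Pi\<^sub>M I (\<lambda>_. borel)). \<forall>y\<in>I. (y, g y) \<in> S}" for q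
  proof -
    have "{g \<in> space (Pi\<^sub>M I (\<lambda>_. borel)). \<forall>y\<in>I. (y, g y) \<in> S} \<in> sets (Pi\<^sub>M I (\<lambda>_. borel))"
      using I by (intro sets.sets_Collect_finite_All) measurable
    moreover have [measurable]: "(\<lambda>\<omega>. \<phi> \<omega> (x + q)) \<in> borel_measurable M" for x
      by (intro measurable_random_field_shift[OF field]) auto
    have "(\<lambda>\<omega>. \<lambda>x\<in>I. \<phi> \<omega> (x + q)) \<in> measurable M (Pi\<^sub>M I (\<lambda>_. borel))"
      by measurable
    ultimately show ?thesis
      by (subst emeasure_distr) (auto simp: space_PiM intro!: arg_cong[where f = "emeasure M"])
  qed
  show ?thesis
    using *[of q] *[of 0] stat I by (simp add: stationary_field_def)
qed

lemma measurable_field_area [measurable]: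
  assumes [measurable]: "S \<in> sets (borel \<Otimes>\<^sub>M borel)"
  shows "field_area \<phi> S q \<in> borel_measurable M"
proof -
  have [measurable]: "(\<lambda>z. \<phi> (fst z) (snd z + q)) \<in> borel_measurable (M \<Otimes>\<^sub>M lborel)"
    by (intro measurable_random_field_shift[OF field]) auto
  have "{z \<in> space (M \<Otimes>\<^sub>M lborel). (snd z, \<phi> (fst z) (snd z + q)) \<in> S} \<in> sets (M \<Otimes>\<^sub>M lborel)"
    by measurable
  from lborel.measurable_emeasure_Pair[OF this] show ?thesis
    by (rule measurable_cong[THEN iffD1, rotated])
      (auto simp: field_area_def space_pair_measure intro!: arg_cong[where f = "emeasure lborel"])
qed

text \<open>The \<open>k\<close>-th moment of a random area is an integral over \<open>k\<close>-tuples of points of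
  finite-dimensional probabilities.\<close>

lemma stationary_moment_eq:
  assumes [measurable]: "S \<in> sets (borel \<Otimes>\<^sub>M borel)"
  shows "(\<integral>\<^sup>+\<omega>. field_area \<phi> S q \<omega> ^ k \<partial>M) = (\<integral>\<^sup>+\<omega>. field_area \<phi> S 0 \<omega> ^ k \<partial>M)"
proof -
  let ?L = "Pi\<^sub>M {..<k} (\<lambda>_. lborel :: (real^2) measure)"
  interpret L: product_sigma_finite "\<lambda>_::nat. lborel :: (real^2) measure" ..
  interpret LL: sigma_finite_measure ?L by (rule L.sigma_finite) simp
  interpret pair_sigma_finite M ?L ..
  have "(\<integral>\<^sup>+\<omega>. field_area \<phi> S q \<omega> ^ k \<partial>M) =
      (\<integral>\<^sup>+x. emeasure M {\<omega> \<in> space M. \<forall>y\<in>x ` {..<k}. (y, \<phi> \<omega> (y + q)) \<in> S} \<partial>?L)" for q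
  proof -
    have pt[measurable]: "(\<lambda>z. \<phi> (fst z) (snd z i + q)) \<in> borel_measurable (M \<Otimes>\<^sub>M ?L)" if "i < k" for i
      using that by (intro measurable_random_field_shift[OF field]) measurable
    \<comment> \<open>A power of an integral is an integral over a product of copies of Lebesgue
      measure.\<close>
    have pow: "field_area \<phi> S q \<omega> ^ k = (\<integral>\<^sup>+x. (\<Prod>i<k. indicator S (x i, \<phi> \<omega> (x i + q))) \<partial>?L)"
      if w: "\<omega> \<in> space M" for \<omega>
    proof -
      have [measurable]: "(\<lambda>y. \<phi> \<omega> (y + q)) \<in> borel_measurable borel"
        using w by (intro measurable_random_field_shift[OF field]) auto
      have "field_area \<phi> S q \<omega> = (\<integral>\<^sup>+y. indicator {y. (y, \<phi> \<omega> (y + q)) \<in> S} y \<partial>lborel)"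
        unfolding field_area_def by (subst nn_integral_indicator) auto
      also have "\<dots> = (\<integral>\<^sup>+y. indicator S (y, \<phi> \<omega> (y + q)) \<partial>lborel)"
        by (intro nn_integral_cong) (auto simp: indicator_def)
      finally show ?thesis
        by (subst L.product_nn_integral_prod) auto
    qed
    have ind: "(\<Prod>i<k. indicator S (x i, \<phi> \<omega> (x i + q))) =
        (indicator {\<omega> \<in> space M. \<forall>y\<in>x ` {..<k}. (y, \<phi> \<omega> (y + q)) \<in> S} \<omega> :: ennreal)"
      if "\<omega> \<in> space M" for x \<omega>
    proof (cases "\<forall>i<k. (x i, \<phi> \<omega> (x i + q)) \<in> S")
      case True
      then show ?thesis using that by simp
    next
      case False
      then obtain i where "i < k" "(x i, \<phi> \<omega> (x i + q)) \<notin> S" by blast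
      moreover from this have "(\<Prod>i<k. indicator S (x i, \<phi> \<omega> (x i + q))) = (0::ennreal)"
        by (intro prod_zero bexI[of _ i]) auto
      ultimately show ?thesis by (subst indicator_simps(2)) auto
    qed
    have "(\<integral>\<^sup>+\<omega>. field_area \<phi> S q \<omega> ^ k \<partial>M) =
        (\<integral>\<^sup>+\<omega>. \<integral>\<^sup>+x. (\<Prod>i<k. indicator S (x i, \<phi> \<omega> (x i + q))) \<partial>?L \<partial>M)"
      by (intro nn_integral_cong pow)
    also have "\<dots> = (\<integral>\<^sup>+x. \<integral>\<^sup>+\<omega>. (\<Prod>i<k. indicator S (x i, \<phi> \<omega> (x i + q))) \<partial>M \<partial>?L)"
      by (intro Fubini'[symmetric]) (simp add: split_beta', measurable)
    also have "\<dots> = (\<integral>\<^sup>+x. emeasure M {\<omega> \<in> space M. \<forall>y\<in>x ` {..<k}. (y, \<phi> \<omega> (y + q)) \<in> S} \<partial>?L)"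
    proof (rule nn_integral_cong)
      fix x
      have [measurable]: "(\<lambda>\<omega>. \<phi> \<omega> y) \<in> borel_measurable M" for y
        by (intro measurable_random_field_shift[OF field]) auto
      have m: "{\<omega> \<in> space M. \<forall>y\<in>x ` {..<k}. (y, \<phi> \<omega> (y + q)) \<in> S} \<in> sets M"
        by (intro sets.sets_Collect_finite_All) auto
      have "(\<integral>\<^sup>+\<omega>. (\<Prod>i<k. indicator S (x i, \<phi> \<omega> (x i + q))) \<partial>M) =
          (\<integral>\<^sup>+\<omega>. indicator {\<omega> \<in> space M. \<forall>y\<in>x ` {..<k}. (y, \<phi> \<omega> (y + q)) \<in> S} \<omega> \<partial>M)"
        by (intro nn_integral_cong ind)
      also have "\<dots> = emeasure M {\<omega> \<in> space M. \<forall>y\<in>x ` {..<k}. (y, \<phi> \<omega> (y + q)) \<in> S}"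
        using m by (rule nn_integral_indicator)
      finally show "(\<integral>\<^sup>+\<omega>. (\<Prod>i<k. indicator S (x i, \<phi> \<omega> (x i + q))) \<partial>M) =
        emeasure M {\<omega> \<in> space M. \<forall>y\<in>x ` {..<k}. (y, \<phi> \<omega> (y + q)) \<in> S}" .
    qed
    finally show ?thesis .
  qed
  from this[of q] this[of 0] show ?thesis
    by (simp only: stationary_finite_eq[OF finite_imageI[OF finite_lessThan] assms] add_0_right)
qed

text \<open>Over a ball the area is bounded by a constant, so its moments, which agree by
  stationarity, determine the Laplace transform through the exponential series.\<close>

lemma stationary_laplace_eq_bounded:
  assumes S [measurable]: "S \<in> sets (borel \<Otimes>\<^sub>M borel)" and bdd: "S \<subseteq> ball 0 r \<times> UNIV" and t: "t > 0"
  shows "(\<integral>\<omega>. exp_neg (ennreal t * field_area \<phi> S q \<omega>) \<partial>M) =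
    (\<integral>\<omega>. exp_neg (ennreal t * field_area \<phi> S 0 \<omega>) \<partial>M)"
proof -
  define c where "c = measure lborel (ball (0::real^2) r)"
  have ball: "emeasure lborel (ball (0::real^2) r) = ennreal c"
    unfolding c_def using emeasure_bounded_finite[of "ball (0::real^2) r"]
    by (intro emeasure_eq_ennreal_measure) simp
  have le: "field_area \<phi> S q \<omega> \<le> ennreal c" for q \<omega>
    unfolding field_area_def ball[symmetric] using bdd by (intro emeasure_mono) auto
  have fin: "field_area \<phi> S q \<omega> \<noteq> \<top>" for q \<omega>
    using le[of q \<omega>] by (auto simp: top_unique)
  have c0: "c \<ge> 0" by (simp add: c_def)
  define U where "U q \<omega> = - t * enn2real (field_area \<phi> S q \<omega>)" for q \<omega>
  have [measurable]: "U q \<in> borel_measurable M" for q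
    unfolding U_def by measurable
  have bound: "\<bar>U q \<omega>\<bar> \<le> t * c" for q \<omega>
  proof -
    have "enn2real (field_area \<phi> S q \<omega>) \<le> c"
      using le c0 by (intro enn2real_leI) auto
    then show ?thesis using t by (simp add: U_def abs_mult)
  qed
  have mom: "(\<integral>\<omega>. U q \<omega> ^ k \<partial>M) = (- t) ^ k * enn2real (\<integral>\<^sup>+\<omega>. field_area \<phi> S q \<omega> ^ k \<partial>M)" for q k
  proof -
    have "(\<integral>\<omega>. U q \<omega> ^ k \<partial>M) = (- t) ^ k * (\<integral>\<omega>. enn2real (field_area \<phi> S q \<omega>) ^ k \<partial>M)"
      by (simp only: U_def power_mult_distrib integral_mult_right_zero)
    also have "(\<integral>\<omega>. enn2real (field_area \<phi> S q \<omega>) ^ k \<partial>M) =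
        enn2real (\<integral>\<^sup>+\<omega>. ennreal (enn2real (field_area \<phi> S q \<omega>) ^ k) \<partial>M)"
      by (rule integral_eq_nn_integral) auto
    also have "(\<integral>\<^sup>+\<omega>. ennreal (enn2real (field_area \<phi> S q \<omega>) ^ k) \<partial>M) =
        (\<integral>\<^sup>+\<omega>. field_area \<phi> S q \<omega> ^ k \<partial>M)"
      using fin by (intro nn_integral_cong) (simp add: ennreal_power[symmetric] ennreal_enn2real_if)
    finally show ?thesis .
  qed
  have "exp_neg (ennreal t * field_area \<phi> S q \<omega>) = exp (U q \<omega>)" for q \<omega>
    using fin t by (simp add: exp_neg_def U_def enn2real_mult ennreal_mult_eq_top_iff)
  moreover have "(\<integral>\<omega>. exp (U q \<omega>) \<partial>M) = (\<integral>\<omega>. exp (U 0 \<omega>) \<partial>M)"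
  proof (rule expectation_exp_eq_if_moments_eq[OF prob_space_axioms])
    show "(\<integral>\<omega>. U q \<omega> ^ k \<partial>M) = (\<integral>\<omega>. U 0 \<omega> ^ k \<partial>M)" for k
      unfolding mom stationary_moment_eq[OF S, of q] ..
  qed (use bound in auto)
  ultimately show ?thesis by simp
qed

text \<open>The areas inside growing balls tend to the full area, finite or not, and
  \<open>exp_neg\<close> is bounded by 1, so dominated convergence removes the restriction to a
  ball.\<close>

lemma stationary_laplace_eq:
  assumes S [measurable]: "S \<in> sets (borel \<Otimes>\<^sub>M borel)" and t: "t > 0"
  shows "(\<integral>\<omega>. exp_neg (ennreal t * field_area \<phi> S q \<omega>) \<partial>M) =
    (\<integral>\<omega>. exp_neg (ennreal t * field_area \<phi> S 0 \<omega>) \<partial>M)"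
proof -
  define T where "T n = S \<inter> (ball 0 (real n) \<times> UNIV)" for n
  have [measurable]: "T n \<in> sets (borel \<Otimes>\<^sub>M borel)" for n
    unfolding T_def by measurable
  have "(\<lambda>n. \<integral>\<omega>. exp_neg (ennreal t * field_area \<phi> (T n) q \<omega>) \<partial>M)
      \<longlonglongrightarrow> (\<integral>\<omega>. exp_neg (ennreal t * field_area \<phi> S q \<omega>) \<partial>M)" for q
  proof (rule integral_dominated_convergence[where w = "\<lambda>_. 1"])
    show "AE \<omega> in M. (\<lambda>n. exp_neg (ennreal t * field_area \<phi> (T n) q \<omega>))
        \<longlonglongrightarrow> exp_neg (ennreal t * field_area \<phi> S q \<omega>)"
    proof (rule AE_I2)
      fix \<omega> assume w: "\<omega> \<in> space M"
      have [measurable]: "(\<lambda>y. \<phi> \<omega> (y + q)) \<in> borel_measurable borel"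
        using w by (intro measurable_random_field_shift[OF field]) auto
      define D where "D = {y. (y, \<phi> \<omega> (y + q)) \<in> S}"
      have D: "D \<in> sets borel" unfolding D_def by measurable
      have T: "field_area \<phi> (T n) q \<omega> = emeasure lborel (D \<inter> ball 0 (real n))" for n
        unfolding field_area_def T_def D_def by (intro arg_cong[where f = "emeasure lborel"]) auto
      have "(\<lambda>n. exp_neg (ennreal t * emeasure lborel (D \<inter> ball 0 (real n))))
        \<longlonglongrightarrow> exp_neg (ennreal t * emeasure lborel D)"
        using emeasure_lborel_Int_ball_finite[OF D, THEN less_imp_neq]
        by (intro exp_neg_tendsto ennreal_tendsto_cmult Int_ball_tendsto_emeasure D)
          (simp_all add: ennreal_mult_eq_top_iff)
      then show "(\<lambda>n. exp_neg (ennreal t * field_area \<phi> (T n) q \<omega>))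
        \<longlonglongrightarrow> exp_neg (ennreal t * field_area \<phi> S q \<omega>)"
        by (simp only: T) (simp only: field_area_def D_def)
    qed
  qed (auto simp: exp_neg_nonneg exp_neg_le_1)
  note lim = this
  have "(\<integral>\<omega>. exp_neg (ennreal t * field_area \<phi> (T n) q \<omega>) \<partial>M) =
      (\<integral>\<omega>. exp_neg (ennreal t * field_area \<phi> (T n) 0 \<omega>) \<partial>M)" for n
    using t by (intro stationary_laplace_eq_bounded[where r = "real n"]) (auto simp: T_def)
  then show ?thesis
    using lim[of q] lim[of 0] by (simp only:) (rule LIMSEQ_unique)
qed

text \<open>As the Laplace parameter \<open>1 / Suc n\<close> tends to 0, the transform of the area
  tends to the probability that the area is finite: an infinite area contributes 0 for every
  \<open>n\<close>, a finite one tends to 1.\<close>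

lemma stationary_prob_area_infinite_eq:
  assumes S [measurable]: "S \<in> sets (borel \<Otimes>\<^sub>M borel)"
  shows "prob {\<omega> \<in> space M. field_area \<phi> S q \<omega> = \<top>} = prob {\<omega> \<in> space M. field_area \<phi> S 0 \<omega> = \<top>}"
proof -
  have lim: "(\<lambda>n. \<integral>\<omega>. exp_neg (ennreal (1 / Suc n) * field_area \<phi> S q \<omega>) \<partial>M)
      \<longlonglongrightarrow> 1 - prob {\<omega> \<in> space M. field_area \<phi> S q \<omega> = \<top>}" for q
  proof -
    have "(\<lambda>n. \<integral>\<omega>. exp_neg (ennreal (1 / Suc n) * field_area \<phi> S q \<omega>) \<partial>M)
        \<longlonglongrightarrow> (\<integral>\<omega>. indicator {\<omega> \<in> space M. field_area \<phi> S q \<omega> \<noteq> \<top>} \<omega> \<partial>M)"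
    proof (rule integral_dominated_convergence[where w = "\<lambda>_. 1"])
      show "AE \<omega> in M. (\<lambda>n. exp_neg (ennreal (1 / Suc n) * field_area \<phi> S q \<omega>))
          \<longlonglongrightarrow> indicator {\<omega> \<in> space M. field_area \<phi> S q \<omega> \<noteq> \<top>} \<omega>"
      proof (rule AE_I2)
        fix \<omega> assume w: "\<omega> \<in> space M"
        show "(\<lambda>n. exp_neg (ennreal (1 / Suc n) * field_area \<phi> S q \<omega>))
          \<longlonglongrightarrow> indicator {\<omega> \<in> space M. field_area \<phi> S q \<omega> \<noteq> \<top>} \<omega>"
        proof (cases "field_area \<phi> S q \<omega> = \<top>")
          case True
          then show ?thesis by (simp add: exp_neg_def ennreal_mult_eq_top_iff)
        next
          case False
          have "(\<lambda>n. exp (- (1 / Suc n * enn2real (field_area \<phi> S q \<omega>)))) \<longlonglongrightarrow>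
              exp (- (0 * enn2real (field_area \<phi> S q \<omega>)))"
            by (intro tendsto_exp tendsto_minus tendsto_mult_right LIMSEQ_Suc lim_1_over_n)
          then show ?thesis
            using w False by (simp add: exp_neg_def enn2real_mult ennreal_mult_eq_top_iff)
        qed
      qed
    qed (auto simp: exp_neg_nonneg exp_neg_le_1)
    also have "(\<integral>\<omega>. indicator {\<omega> \<in> space M. field_area \<phi> S q \<omega> \<noteq> \<top>} \<omega> \<partial>M) =
        prob {\<omega> \<in> space M. field_area \<phi> S q \<omega> \<noteq> \<top>}"
      by simp
    also have "\<dots> = 1 - prob {\<omega> \<in> space M. field_area \<phi> S q \<omega> = \<top>}"
      by (subst prob_neg[symmetric]) auto
    finally show ?thesis .
  qed
  have "1 - prob {\<omega> \<in> space M. field_area \<phi> S q \<omega> = \<top>} = 1 - prob {\<omega> \<in> space M. field_area \<phi> S 0 \<omega> = \<top>}"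
  proof (rule LIMSEQ_unique[OF _ lim[of 0]])
    have "(\<integral>\<omega>. exp_neg (ennreal (1 / Suc n) * field_area \<phi> S q \<omega>) \<partial>M) =
        (\<integral>\<omega>. exp_neg (ennreal (1 / Suc n) * field_area \<phi> S 0 \<omega>) \<partial>M)" for n
      by (intro stationary_laplace_eq S) simp
    then show "(\<lambda>n. \<integral>\<omega>. exp_neg (ennreal (1 / Suc n) * field_area \<phi> S 0 \<omega>) \<partial>M)
        \<longlonglongrightarrow> 1 - prob {\<omega> \<in> space M. field_area \<phi> S q \<omega> = \<top>}"
      using lim[of q] by (simp only:)
  qed
  then show ?thesis by simp
qed

end

section \<open>Hyperbolic cones at infinity\<close>

text \<open>The events increase with \<open>n\<close>, so continuity from below carries the
  invariance over to their union.\<close>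

lemma prob_ex_area_infinite_eq:
  assumes field: "random_field M \<phi>" and stat: "stationary_field M \<phi>"
    and S [measurable]: "\<And>n::nat. S n \<in> sets (borel \<Otimes>\<^sub>M borel)" and mono: "incseq S"
  shows "measure M {\<omega> \<in> space M. \<exists>n. field_area \<phi> (S n) q \<omega> = \<top>} =
    measure M {\<omega> \<in> space M. \<exists>n. field_area \<phi> (S n) 0 \<omega> = \<top>}"
proof -
  interpret prob_space M using field by (simp add: random_field_def)
  have [measurable]: "field_area \<phi> (S n) q \<in> borel_measurable M" for n q
    by (intro measurable_field_area field stat S)
  have lim: "(\<lambda>n. prob {\<omega> \<in> space M. field_area \<phi> (S n) q \<omega> = \<top>})
      \<longlonglongrightarrow> prob {\<omega> \<in> space M. \<exists>n. field_area \<phi> (S n) q \<omega> = \<top>}" for q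
  proof -
    have "incseq (\<lambda>n. {\<omega> \<in> space M. field_area \<phi> (S n) q \<omega> = \<top>})"
    proof (intro incseq_SucI subsetI)
      fix n \<omega> assume w: "\<omega> \<in> {\<omega> \<in> space M. field_area \<phi> (S n) q \<omega> = \<top>}"
      then have [measurable]: "(\<lambda>y. \<phi> \<omega> (y + q)) \<in> borel_measurable borel"
        by (intro measurable_random_field_shift[OF field]) auto
      have "field_area \<phi> (S n) q \<omega> \<le> field_area \<phi> (S (Suc n)) q \<omega>"
        unfolding field_area_def using incseq_SucD[OF mono, of n] by (intro emeasure_mono) auto
      then show "\<omega> \<in> {\<omega> \<in> space M. field_area \<phi> (S (Suc n)) q \<omega> = \<top>}"
        using w by (simp add: top_unique)
    qed
    then have "(\<lambda>n. prob {\<omega> \<in> space M. field_area \<phi> (S n) q \<omega> = \<top>})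
      \<longlonglongrightarrow> prob (\<Union>n. {\<omega> \<in> space M. field_area \<phi> (S n) q \<omega> = \<top>})"
      by (intro finite_Lim_measure_incseq) auto
    moreover have "(\<Union>n. {\<omega> \<in> space M. field_area \<phi> (S n) q \<omega> = \<top>}) =
        {\<omega> \<in> space M. \<exists>n. field_area \<phi> (S n) q \<omega> = \<top>}" by auto
    ultimately show ?thesis by simp
  qed
  show ?thesis
    using lim[of q] lim[of 0]
    unfolding stationary_prob_area_infinite_eq[OF field stat S, of _ q] by (rule LIMSEQ_unique)
qed

text \<open>The vectors with coordinates \<plusminus>1, indexed by the set of positive coordinates;
  in the plane this makes the four directions a finite type.\<close>

definition sign_vec :: "'n::finite set \<Rightarrow> real^'n" where
  "sign_vec A = (\<chi> i. if i \<in> A then 1 else - 1)"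

text \<open>With the signs of \<open>x\<close> itself the inner product is the l1 norm, which
  dominates the Euclidean norm. Hence the cones along the sign vectors cover the space.\<close>

lemma norm_le_sign_vec_inner:
  fixes x :: "real^'n::finite"
  shows "norm x \<le> sign_vec {i. 0 \<le> x $ i} \<bullet> x"
proof -
  have "norm x \<le> (\<Sum>i\<in>UNIV. \<bar>x $ i\<bar>)" by (rule norm_le_l1_cart)
  also have "\<dots> = sign_vec {i. 0 \<le> x $ i} \<bullet> x"
    by (auto simp: inner_vec_def sign_vec_def intro!: sum.cong)
  finally show ?thesis .
qed

lemma sign_vec_inner_self: "sign_vec A \<bullet> sign_vec A = CARD('n)" for A :: "'n::finite set"
proof -
  have "sign_vec A \<bullet> sign_vec A = (\<Sum>i\<in>(UNIV::'n set). 1)"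
    unfolding inner_vec_def sign_vec_def by (intro sum.cong) auto
  then show ?thesis by simp
qed

text \<open>By \<open>cone\<close> and \<open>far\<close>, \<open>e \<bullet> x\<close> is at least
  \<open>norm x / 2\<close>. In the expansion of the squared norm the cross term is therefore at
  least \<open>r * norm x\<close>, and \<open>e\<close> being of length at least 1 leaves more than
  the remaining square of \<open>r / 2\<close> requires.\<close>

lemma norm_shift_margin:
  fixes x e :: "'a::real_inner"
  assumes cone: "norm x \<le> e \<bullet> x + n" and far: "2 * n \<le> norm x" and e: "1 \<le> e \<bullet> e" and r: "0 \<le> r"
  shows "norm x + r / 2 \<le> norm (x + r *\<^sub>R e)"
proof (rule power2_le_imp_le)
  have "(norm (x + r *\<^sub>R e))\<^sup>2 = (norm x)\<^sup>2 + 2 * (r * (e \<bullet> x)) + r\<^sup>2 * (e \<bullet> e)"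
    unfolding power2_norm_eq_inner
    by (simp add: inner_add_left inner_add_right inner_commute power2_eq_square)
  moreover have "r * (norm x / 2) \<le> r * (e \<bullet> x)"
    using cone far r by (intro mult_left_mono) auto
  moreover have "r\<^sup>2 * 1 \<le> r\<^sup>2 * (e \<bullet> e)"
    using e by (intro mult_left_mono) auto
  moreover have "(norm x + r / 2)\<^sup>2 = (norm x)\<^sup>2 + r * norm x + r\<^sup>2 / 4"
    by (simp add: power2_eq_square field_simps)
  moreover have "r\<^sup>2 \<ge> 0" by simp
  ultimately show "(norm x + r / 2)\<^sup>2 \<le> (norm (x + r *\<^sub>R e))\<^sup>2"
    by linarith
qed simp

section \<open>Infinite areas in cones\<close>

lemma emeasure_lborel_translate:
  fixes A :: "'a::euclidean_space set"
  assumes "A \<in> sets borel"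
  shows "emeasure lborel {x. x + c \<in> A} = emeasure lborel A"
proof -
  have "emeasure lborel A = emeasure (distr lborel borel ((+) c)) A"
    by (simp add: lborel_distr_plus)
  also have "\<dots> = emeasure lborel {x. x + c \<in> A}"
    using assms by (subst emeasure_distr) (auto simp: vimage_def add.commute)
  finally show ?thesis ..
qed

text \<open>For \<open>e\<close> with coordinates \<plusminus>1 the positions form a quadrant if
  \<open>n = 0\<close>, and otherwise the inside of a branch of a hyperbola; increasing
  \<open>n\<close> absorbs translations. The second condition says that the disc of radius
  \<open>v\<close> around \<open>y\<close> reaches the observer.\<close>

definition cone_disc :: "real^2 \<Rightarrow> nat \<Rightarrow> ((real^2) \<times> real) set" where
  "cone_disc e n = {(y, v). norm y \<le> e \<bullet> y + real n \<and> norm y \<le> v}"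

lemma sets_cone_disc [measurable]: "cone_disc e n \<in> sets (borel \<Otimes>\<^sub>M borel)"
proof -
  have "{z \<in> space (borel \<Otimes>\<^sub>M borel :: ((real^2) \<times> real) measure).
      norm (fst z) \<le> e \<bullet> fst z + real n \<and> norm (fst z) \<le> snd z} \<in> sets (borel \<Otimes>\<^sub>M borel)"
    by measurable
  then show ?thesis by (simp add: cone_disc_def space_pair_measure case_prod_beta')
qed

lemma incseq_cone_disc: "incseq (cone_disc e)"
  by (rule incseq_SucI) (auto simp: cone_disc_def)

text \<open>Deep inside the cone the disc condition seen from \<open>- r e\<close> beats the one seen from the
  origin by \<open>r / 2\<close>.\<close>

lemma cone_area_margin:
  fixes f :: "real^2 \<Rightarrow> real"
  assumes [measurable]: "f \<in> borel_measurable borel" and e: "1 \<le> e \<bullet> e" and r: "0 \<le> r"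
    and top: "emeasure lborel {y. (y, f (y - r *\<^sub>R e)) \<in> cone_disc e n} = \<top>"
  shows "\<exists>m. emeasure lborel {x. norm x \<le> e \<bullet> x + real m \<and> norm x + r / 2 \<le> f x} = \<top>"
proof -
  \<comment> \<open>Moving the apex by \<open>r *\<^sub>R e\<close> costs
    \<open>r * (e \<bullet> e)\<close> in the inner product and at most \<open>r * norm e\<close> in
    the norm.\<close>
  define m where "m = nat \<lceil>real n + r * (e \<bullet> e) + r * norm e\<rceil>"
  have m: "real n + r * (e \<bullet> e) + r * norm e \<le> real m"
    unfolding m_def by linarith
  define A where "A = {y. (y, f (y - r *\<^sub>R e)) \<in> cone_disc e n}"
  have A: "A \<in> sets borel"
    unfolding A_def by measurable
  define B where "B = {x. norm x \<le> e \<bullet> x + real m \<and> norm x + r / 2 \<le> f x}"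
  have [measurable]: "B \<in> sets borel"
    unfolding B_def by measurable
  have "{x. x + r *\<^sub>R e \<in> A} \<subseteq> B \<union> ball 0 (2 * real m)"
  proof (rule subsetI, rule ccontr)
    fix x assume "x \<in> {x. x + r *\<^sub>R e \<in> A}" and "x \<notin> B \<union> ball 0 (2 * real m)"
    then have in_cone: "norm (x + r *\<^sub>R e) \<le> e \<bullet> (x + r *\<^sub>R e) + real n" and f: "norm (x + r *\<^sub>R e) \<le> f x"
      and far: "2 * real m \<le> norm x" and "x \<notin> B"
      by (auto simp: A_def cone_disc_def)
    have "norm x \<le> norm (x + r *\<^sub>R e) + norm (r *\<^sub>R e)"
      using norm_triangle_ineq4[of "x + r *\<^sub>R e" "r *\<^sub>R e"] by simp
    then have "norm x \<le> e \<bullet> x + real m"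
      using in_cone m r by (simp add: inner_add_right)
    moreover from norm_shift_margin[OF this far e r] have "norm x + r / 2 \<le> f x"
      using f by linarith
    ultimately show False using \<open>x \<notin> B\<close> by (simp add: B_def)
  qed
  then have "emeasure lborel {x. x + r *\<^sub>R e \<in> A} \<le> emeasure lborel (B \<union> ball 0 (2 * real m))"
    by (intro emeasure_mono) auto
  also have "\<dots> \<le> emeasure lborel B + emeasure lborel (ball (0::real^2) (2 * real m))"
    by (intro emeasure_subadditive) auto
  finally have "\<top> \<le> emeasure lborel B + emeasure lborel (ball (0::real^2) (2 * real m))"
    using emeasure_lborel_translate[OF A, of "r *\<^sub>R e"] top A_def by (simp only:)
  then have "emeasure lborel B = \<top>"
    using emeasure_bounded_finite[of "ball (0::real^2) (2 * real m)"] by (auto simp: top_unique)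
  then show ?thesis unfolding B_def by blast
qed

lemma AE_area_margin:
  assumes field: "random_field M \<phi>" and stat: "stationary_field M \<phi>" and r: "0 \<le> r"
    and inf: "AE \<omega> in M. emeasure lborel {x. norm x \<le> \<phi> \<omega> x} = \<top>"
  shows "AE \<omega> in M. emeasure lborel {x. norm x + r / 2 \<le> \<phi> \<omega> x} = \<top>"
proof -
  interpret prob_space M using field by (simp add: random_field_def)
  have [measurable]: "field_area \<phi> (cone_disc e n) q \<in> borel_measurable M" for e n q
    by (intro measurable_field_area field stat sets_cone_disc)
  have meas: "\<phi> \<omega> \<in> borel_measurable borel" if "\<omega> \<in> space M" for \<omega>
    using measurable_random_field_shift[OF field, of "\<lambda>_. \<omega>" borel "\<lambda>x. x"] that by simp
  \<comment> \<open>The event that the direction \<open>sign_vec A\<close> is bad at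
    \<open>q\<close>.\<close>
  define G where "G A q = {\<omega> \<in> space M. \<exists>n. field_area \<phi> (cone_disc (sign_vec A) n) q \<omega> = \<top>}"
    for A :: "2 set" and q
  have G_sets [measurable]: "G A q \<in> sets M" for A q
    unfolding G_def by measurable
  have e: "1 \<le> sign_vec A \<bullet> sign_vec A" for A :: "2 set"
    by (simp add: sign_vec_inner_self)
  have margin: "\<exists>m. emeasure lborel {x. norm x \<le> sign_vec A \<bullet> x + real m \<and> norm x + r / 2 \<le> \<phi> \<omega> x} = \<top>"
    if "\<omega> \<in> G A (- r *\<^sub>R sign_vec A)" for \<omega> A
    using that cone_area_margin[OF meas e r, of \<omega> A] by (auto simp: G_def field_area_def)
  have sub: "G A (- r *\<^sub>R sign_vec A) \<subseteq> G A 0" for A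
  proof
    fix \<omega> assume w: "\<omega> \<in> G A (- r *\<^sub>R sign_vec A)"
    from margin[OF this] obtain m where
      m: "emeasure lborel {x. norm x \<le> sign_vec A \<bullet> x + real m \<and> norm x + r / 2 \<le> \<phi> \<omega> x} = \<top>" ..
    have [measurable]: "\<phi> \<omega> \<in> borel_measurable borel" using w by (intro meas) (simp add: G_def)
    have "emeasure lborel {x. norm x \<le> sign_vec A \<bullet> x + real m \<and> norm x + r / 2 \<le> \<phi> \<omega> x}
        \<le> emeasure lborel {x. (x, \<phi> \<omega> x) \<in> cone_disc (sign_vec A) m}"
      using r by (intro emeasure_mono) (auto simp: cone_disc_def)
    then show "\<omega> \<in> G A 0"
      using w m by (auto simp: G_def field_area_def top_unique intro!: exI[of _ m])
  qed
  \<comment> \<open>The converse of \<open>sub\<close> up to a null set: nested events of equal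
    probability differ by a null set. This is where stationarity yields the margin.\<close>
  have G_AE: "AE \<omega> in M. \<omega> \<in> G A 0 \<longrightarrow> \<omega> \<in> G A (- r *\<^sub>R sign_vec A)" for A
  proof -
    have "prob (G A 0 - G A (- r *\<^sub>R sign_vec A)) = prob (G A 0) - prob (G A (- r *\<^sub>R sign_vec A))"
      using sub by (intro finite_measure_Diff) auto
    also have "\<dots> = 0"
      unfolding G_def
        prob_ex_area_infinite_eq[OF field stat sets_cone_disc incseq_cone_disc, of _ "- r *\<^sub>R sign_vec A"]
      by simp
    finally have "G A 0 - G A (- r *\<^sub>R sign_vec A) \<in> null_sets M"
      by (simp add: null_sets_def emeasure_eq_measure)
    from AE_not_in[OF this] show ?thesis by eventually_elim auto
  qed
  have "AE \<omega> in M. \<forall>A. \<omega> \<in> G A 0 \<longrightarrow> \<omega> \<in> G A (- r *\<^sub>R sign_vec A)"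
    using G_AE by (simp add: AE_all_countable)
  with inf AE_space show ?thesis
  proof eventually_elim
    case (elim \<omega>)
    have [measurable]: "\<phi> \<omega> \<in> borel_measurable borel" using elim by (intro meas)
    \<comment> \<open>Already the quadrants, with \<open>n = 0\<close>, cover the plane, so one of
      finitely many carries infinite area.\<close>
    have "{x. norm x \<le> \<phi> \<omega> x} \<subseteq> (\<Union>A\<in>UNIV. {x. (x, \<phi> \<omega> x) \<in> cone_disc (sign_vec A) 0})"
      using norm_le_sign_vec_inner by (auto simp: cone_disc_def)
    then have "emeasure lborel {x. norm x \<le> \<phi> \<omega> x} \<le>
        emeasure lborel (\<Union>A\<in>UNIV. {x. (x, \<phi> \<omega> x) \<in> cone_disc (sign_vec A) 0})"
      by (intro emeasure_mono) auto
    also have "\<dots> \<le> (\<Sum>A\<in>UNIV. emeasure lborel {x. (x, \<phi> \<omega> x) \<in> cone_disc (sign_vec A) 0})"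
      by (intro emeasure_subadditive_finite) auto
    finally have "(\<Sum>A\<in>UNIV. emeasure lborel {x. (x, \<phi> \<omega> x) \<in> cone_disc (sign_vec A) 0}) = \<top>"
      using elim by (simp add: top_unique)
    then obtain A where "emeasure lborel {x. (x, \<phi> \<omega> x) \<in> cone_disc (sign_vec A) 0} = \<top>"
      by auto
    then have "\<omega> \<in> G A 0"
      using elim by (auto simp: G_def field_area_def)
    then obtain m where
      m: "emeasure lborel {x. norm x \<le> sign_vec A \<bullet> x + real m \<and> norm x + r / 2 \<le> \<phi> \<omega> x} = \<top>"
      using elim margin by blast
    have "emeasure lborel {x. norm x \<le> sign_vec A \<bullet> x + real m \<and> norm x + r / 2 \<le> \<phi> \<omega> x}
        \<le> emeasure lborel {x. norm x + r / 2 \<le> \<phi> \<omega> x}"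
      by (intro emeasure_mono) auto
    with m show ?case by (simp add: top_unique)
  qed
qed

section \<open>Coverage\<close>

lemma joint_prob_cong:
  assumes "\<And>\<eta> \<omega>. \<omega> \<in> space M \<Longrightarrow> E \<eta> \<omega> \<longleftrightarrow> F \<eta> \<omega>"
  shows "joint_prob P M E = joint_prob P M F"
  unfolding joint_prob_def joint_law_def using assms
  by (intro arg_cong[where f = "measure _"]) (auto simp: space_pair_measure)

text \<open>For \<open>c\<close> at least 0 the points sought are the centres whose disc contains
  the disc of radius \<open>c\<close> around the origin. The criterion on the right is free of
  \<open>lam\<close>.\<close>

lemma joint_prob_disc_eq_1_iff:
  assumes P: "poisson_law lam P" "lam > 0" and field: "random_field M \<phi>"
  shows "joint_prob P M (\<lambda>\<eta> \<omega>. \<exists>x\<in>\<eta>. norm x + c \<le> \<phi> \<omega> x) = 1 \<longleftrightarrow>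
    (AE \<omega> in M. emeasure lborel {x. norm x + c \<le> \<phi> \<omega> x} = \<top>)"
proof -
  let ?S = "{z \<in> space (M \<Otimes>\<^sub>M borel). norm (snd z) + c \<le> \<phi> (fst z) (snd z)}"
  have [measurable]: "(\<lambda>z. \<phi> (fst z) (snd z)) \<in> borel_measurable (M \<Otimes>\<^sub>M borel)"
    by (intro measurable_random_field_shift[OF field]) auto
  have S: "?S \<in> sets (M \<Otimes>\<^sub>M borel)" by measurable
  have M: "prob_space M" using field by (simp add: random_field_def)
  have "joint_prob P M (\<lambda>\<eta> \<omega>. \<exists>x\<in>\<eta>. norm x + c \<le> \<phi> \<omega> x) =
      joint_prob P M (\<lambda>\<eta> \<omega>. \<exists>x\<in>\<eta>. (\<omega>, x) \<in> ?S)"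
    by (rule joint_prob_cong) (simp add: space_pair_measure)
  also have "\<dots> = 1 \<longleftrightarrow> (AE \<omega> in M. emeasure lborel {x. (\<omega>, x) \<in> ?S} = \<top>)"
    by (rule joint_prob_hit_eq_1_iff[OF P M S])
  also have "\<dots> \<longleftrightarrow> (AE \<omega> in M. emeasure lborel {x. norm x + c \<le> \<phi> \<omega> x} = \<top>)"
    by (intro AE_cong) (simp add: space_pair_measure)
  finally show ?thesis .
qed

text \<open>The summand 0 gives the condition the shape of a margin, namely
  \<open>c = 0\<close>.\<close>

lemma mem_occupied_0_iff: "0 \<in> occupied \<eta> f \<longleftrightarrow> (\<exists>x\<in>\<eta>. norm x + 0 \<le> f x)"
  by (simp add: occupied_def)

text \<open>By the triangle inequality a disc with margin \<open>k\<close> contains the disc of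
  radius \<open>k\<close> around the origin, and any point lies in the latter for large
  \<open>k\<close>.\<close>

lemma occupied_eq_UNIV:
  assumes "\<And>k::nat. \<exists>x\<in>\<eta>. norm x + real k \<le> f x"
  shows "occupied \<eta> f = UNIV"
proof -
  have "y \<in> occupied \<eta> f" for y
  proof -
    obtain k :: nat where k: "norm y \<le> real k" using real_arch_simple by blast
    obtain x where x: "x \<in> \<eta>" "norm x + real k \<le> f x" using assms by blast
    have "dist x y \<le> norm x + norm y" by (simp add: dist_norm norm_triangle_ineq4)
    with k x have "y \<in> cball x (f x)" by simp
    with x(1) show ?thesis by (auto simp: occupied_def)
  qed
  then show ?thesis by auto
qed

theorem proposition4:
  fixes P :: "real \<Rightarrow> (real^2) set measure"
    and M :: "'w measure"
    and \<phi> :: "'w \<Rightarrow> real^2 \<Rightarrow> real"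
    and W :: "(real^2 \<Rightarrow> real) set"
  assumes "\<And>lam. lam > 0 \<Longrightarrow> poisson_law lam (P lam)"
    and "random_field M \<phi>"
    and "path_space M \<phi> W"
    and "stationary_field M \<phi>"
    and "ergodic_field M \<phi> W"
  shows "((\<exists>lam>0. joint_prob (P lam) M (\<lambda>\<eta> \<omega>. 0 \<in> occupied \<eta> (\<phi> \<omega>)) = 1) \<longleftrightarrow>
          (\<forall>lam>0. joint_prob (P lam) M (\<lambda>\<eta> \<omega>. 0 \<in> occupied \<eta> (\<phi> \<omega>)) = 1)) \<and>
         ((\<forall>lam>0. joint_prob (P lam) M (\<lambda>\<eta> \<omega>. 0 \<in> occupied \<eta> (\<phi> \<omega>)) = 1) \<longleftrightarrow>
          (\<forall>lam>0. joint_prob (P lam) M (\<lambda>\<eta> \<omega>. occupied \<eta> (\<phi> \<omega>) = UNIV) = 1))"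
proof -
  \<comment> \<open>A property of the field alone; for every \<open>lam\<close> both coverage
    statements will be reduced to \<open>wide 0\<close>.\<close>
  define wide where "wide c \<longleftrightarrow> (AE \<omega> in M. emeasure lborel {x. norm x + c \<le> \<phi> \<omega> x} = \<top>)" for c
  have M: "prob_space M" using assms(2) by (simp add: random_field_def)
  have origin: "joint_prob (P lam) M (\<lambda>\<eta> \<omega>. 0 \<in> occupied \<eta> (\<phi> \<omega>)) = 1 \<longleftrightarrow> wide 0" if "lam > 0" for lam
    unfolding mem_occupied_0_iff wide_def
    using joint_prob_disc_eq_1_iff[OF assms(1)[OF that] that assms(2)] .
  have margin: "wide (real k)" if "wide 0" for k
    \<comment> \<open>The gain is half the length of the shift, hence
      \<open>2 * real k\<close>.\<close>
    using AE_area_margin[OF assms(2,4), of "2 * real k"] that by (simp add: wide_def)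
  have cover: "joint_prob (P lam) M (\<lambda>\<eta> \<omega>. occupied \<eta> (\<phi> \<omega>) = UNIV) = 1 \<longleftrightarrow> wide 0" if lam: "lam > 0" for lam
  proof -
    have P: "prob_space (P lam)" using assms(1)[OF lam] by (simp add: poisson_law_def)
    note AE_iff = joint_prob_eq_1_iff_AE[OF P M]
    show ?thesis
    proof
      assume "wide 0"
      then have "AE z in completion (P lam \<Otimes>\<^sub>M M). \<exists>x\<in>fst z. norm x + real k \<le> \<phi> (snd z) x" for k
        using margin joint_prob_disc_eq_1_iff[OF assms(1)[OF lam] lam assms(2), of "real k"]
        unfolding wide_def AE_iff by blast
      \<comment> \<open>Integer margins suffice, so only countably many null sets are
        discarded.\<close>
      then have "AE z in completion (P lam \<Otimes>\<^sub>M M). \<forall>k::nat. \<exists>x\<in>fst z. norm x + real k \<le> \<phi> (snd z) x"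
        unfolding AE_all_countable by blast
      then show "joint_prob (P lam) M (\<lambda>\<eta> \<omega>. occupied \<eta> (\<phi> \<omega>) = UNIV) = 1"
        unfolding AE_iff by eventually_elim (rule occupied_eq_UNIV, blast)
    next
      assume "joint_prob (P lam) M (\<lambda>\<eta> \<omega>. occupied \<eta> (\<phi> \<omega>) = UNIV) = 1"
      then have "joint_prob (P lam) M (\<lambda>\<eta> \<omega>. 0 \<in> occupied \<eta> (\<phi> \<omega>)) = 1"
        unfolding AE_iff by eventually_elim simp
      then show "wide 0" by (simp only: origin[OF lam])
    qed
  qed
  \<comment> \<open>A positive intensity is needed to pass from all intensities to some.\<close>
  have "(1::real) > 0" by simp
  then show ?thesis
    using origin cover by blast
qed

end
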